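(* Let $T>0$, $\delta\in(0,1]$, and let $w:[0,T]\to\mathbb{R}$ be a $\delta$-Hölder continuous function. Then for all $\gamma,\rho>0$ such that $\gamma+\delta>1$ and $\rho>(1-\gamma)/\delta$ one has $\|\Phi^w\|_{\mathcal{W}^{\rho,\gamma}_T}=+\infty$.
   Context: For a continuous function $w:[0,T]\to\mathbb{R}$, $\Phi^w_t(a)=\int_0^t e^{iaw_r}\,dr$ and $$\|\Phi^w\|_{\mathcal{W}^{\rho,\gamma}_T}=\sup_{a\in\mathbb{R}}\ \sup_{0\le s<t\le T}(1+|a|)^\rho\,\frac{|\Phi^w_t(a)-\Phi^w_s(a)|}{|t-s|^\gamma}\in[0,+\infty].$$ *)

theory Defs
  imports "HOL-Analysis.Analysis"
begin

definition holder_on :: "real \<Rightarrow> real set \<Rightarrow> (real \<Rightarrow> real) \<Rightarrow> bool" where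
  "holder_on \<delta> S w \<longleftrightarrow> (\<exists>C. \<forall>s\<in>S. \<forall>t\<in>S. \<bar>w t - w s\<bar> \<le> C * \<bar>t - s\<bar> powr \<delta>)"

(* A path on [0,T] is a total function real => real, of which only the values on [0,T] matter. *)
definition Phi :: "(real \<Rightarrow> real) \<Rightarrow> real \<Rightarrow> real \<Rightarrow> complex" where
  "Phi w t a = integral {0..t} (\<lambda>r. exp (\<i> * complex_of_real (a * w r)))"

definition W_norm :: "real \<Rightarrow> real \<Rightarrow> real \<Rightarrow> (real \<Rightarrow> real \<Rightarrow> complex) \<Rightarrow> ennreal" where
  "W_norm \<rho> \<gamma> T F =
     (SUP a. SUP (s, t) \<in> {(s, t). 0 \<le> s \<and> s < t \<and> t \<le> T}.
        ennreal ((1 + \<bar>a\<bar>) powr \<rho> * (cmod (F t a - F s a) / \<bar>t - s\<bar> powr \<gamma>)))"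

end

theory Submission
  imports Defs "HOL-Real_Asymp.Real_Asymp"
begin

text \<open>
  On \<open>[0, h]\<close> the path oscillates by at most \<open>C h\<^sup>\<delta>\<close>, so at the frequency \<open>a = 1 / (C h\<^sup>\<delta>)\<close> the
  phase moves by at most \<open>1\<close> and there is no cancellation: \<open>|\<Phi>\<^sub>h(a) - \<Phi>\<^sub>0(a)| \<ge> h cos 1\<close>. The
  quotient in the norm is therefore at least a constant times \<open>h\<close> to the power
  \<open>1 - \<gamma> - \<delta> \<rho> < 0\<close>, which is unbounded as \<open>h\<close> tends to \<open>0\<close>.
\<close>

lemma cos_one_pos: "0 < cos (1 :: real)"
  using cos_gt_zero_pi[of 1] pi_gt3 by simp

text \<open>The constant in \<open>holder_on\<close> may be zero or negative; passing to
  \<open>max C 1\<close> makes it positive, so that the frequency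
  \<open>1 / (C * h powr \<delta>)\<close> makes sense.\<close>

lemma holder_onE:
  assumes "holder_on \<delta> S w"
  obtains C where "C > 0"
    and "\<And>s t. s \<in> S \<Longrightarrow> t \<in> S \<Longrightarrow> \<bar>w t - w s\<bar> \<le> C * \<bar>t - s\<bar> powr \<delta>"
proof -
  obtain C where C: "\<And>s t. s \<in> S \<Longrightarrow> t \<in> S \<Longrightarrow> \<bar>w t - w s\<bar> \<le> C * \<bar>t - s\<bar> powr \<delta>"
    using assms unfolding holder_on_def by blast
  have "C * \<bar>t - s\<bar> powr \<delta> \<le> max C 1 * \<bar>t - s\<bar> powr \<delta>" for s t
    by (rule mult_right_mono) auto
  then show ?thesis
    by (intro that[of "max C 1"]) (auto intro: order_trans[OF C])
qed

lemma holder_on_imp_continuous_on: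
  assumes "holder_on \<delta> S w" "\<delta> > 0"
  shows "continuous_on S w"
  unfolding continuous_on_def
proof
  fix x assume x: "x \<in> S"
  obtain C where C: "\<And>s t. s \<in> S \<Longrightarrow> t \<in> S \<Longrightarrow> \<bar>w t - w s\<bar> \<le> C * \<bar>t - s\<bar> powr \<delta>"
    using assms(1) by (rule holder_onE) blast
  \<comment> \<open>The base tends to 0, where \<open>powr\<close> is continuous in the base only
    because the exponent is positive.\<close>
  have "((\<lambda>y. C * \<bar>y - x\<bar> powr \<delta>) \<longlongrightarrow> C * \<bar>x - x\<bar> powr \<delta>) (at x within S)"
    using \<open>\<delta> > 0\<close> by (intro tendsto_intros tendsto_powr') auto
  then have "((\<lambda>y. C * \<bar>y - x\<bar> powr \<delta>) \<longlongrightarrow> 0) (at x within S)"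
    by simp
  then have "((\<lambda>y. w y - w x) \<longlongrightarrow> 0) (at x within S)"
    by (rule Lim_null_comparison[rotated]) (use C x in \<open>auto simp: eventually_at_filter\<close>)
  then show "(w \<longlongrightarrow> w x) (at x within S)"
    by (rule LIM_zero_cancel)
qed

text \<open>Rotating by the unit number \<open>exp (- \<i> * c)\<close> keeps the modulus of the
  integral and turns the real part of the integrand into \<open>cos (f r - c)\<close>, which is at
  least \<open>cos 1\<close>. The modulus dominates the real part.\<close>

lemma cmod_integral_exp_ge:
  fixes f :: "real \<Rightarrow> real"
  assumes f: "continuous_on {s..t} f" and "s \<le> t"
    and near: "\<And>r. r \<in> {s..t} \<Longrightarrow> \<bar>f r - c\<bar> \<le> 1"
  shows "(t - s) * cos 1 \<le> cmod (integral {s..t} (\<lambda>r. exp (\<i> * complex_of_real (f r))))"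
proof -
  let ?e = "\<lambda>r. exp (\<i> * complex_of_real (f r))"
  let ?u = "exp (\<i> * complex_of_real (- c))"
  have e: "?e integrable_on {s..t}"
    by (intro integrable_continuous_real continuous_intros f)
  then have ue: "(\<lambda>r. ?u * ?e r) integrable_on {s..t}"
    by (rule integrable_on_mult_right)
  have Re: "Re (?u * ?e r) = cos (f r - c)" for r
    by (simp add: Re_exp Im_exp cos_diff)
  have "(t - s) * cos 1 = integral {s..t} (\<lambda>_. cos 1)"
    using \<open>s \<le> t\<close> by simp
  also have "\<dots> \<le> integral {s..t} (\<lambda>r. cos (f r - c))"
  proof (rule integral_le)
    show "(\<lambda>r. cos (f r - c)) integrable_on {s..t}"
      by (intro integrable_continuous_real continuous_intros f)
    show "cos 1 \<le> cos (f r - c)" if "r \<in> {s..t}" for r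
      \<comment> \<open>Cosine is even and decreasing on \<open>{0..pi}\<close>, and 1 lies below
        \<open>pi\<close>.\<close>
      using cos_monotone_0_pi_le[of "\<bar>f r - c\<bar>" 1] near[OF that] pi_gt3 by simp
  qed auto
  also have "\<dots> = Re (integral {s..t} (\<lambda>r. ?u * ?e r))"
    using integral_linear[OF ue bounded_linear_Re] by (simp only: o_def Re)
  also have "\<dots> \<le> cmod (integral {s..t} (\<lambda>r. ?u * ?e r))"
    by (rule complex_Re_le_cmod)
  also have "\<dots> = cmod (integral {s..t} ?e)"
    by (simp add: norm_mult)
  finally show ?thesis .
qed

lemma W_norm_upper:
  assumes "0 \<le> s" "s < t" "t \<le> T"
  shows "ennreal ((1 + \<bar>a\<bar>) powr \<rho> * (cmod (F t a - F s a) / \<bar>t - s\<bar> powr \<gamma>)) \<le> W_norm \<rho> \<gamma> T F"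
  unfolding W_norm_def
  by (rule SUP_upper2[of a]) (use assms in \<open>auto intro!: SUP_upper2[of "(s, t)"]\<close>)

lemma W_norm_Phi_ge:
  assumes "C > 0" "\<delta> > 0" "\<rho> > 0" "0 < h" "h \<le> T" "continuous_on {0..T} w"
    and w: "\<And>r. r \<in> {0..T} \<Longrightarrow> \<bar>w r - w 0\<bar> \<le> C * r powr \<delta>"
  shows "ennreal (C powr - \<rho> * cos 1 * h powr (1 - \<gamma> - \<delta> * \<rho>)) \<le> W_norm \<rho> \<gamma> T (Phi w)"
proof -
  define a where "a = 1 / (C * h powr \<delta>)"
  have "a > 0"
    using assms by (simp add: a_def)
  have near: "\<bar>a * w r - a * w 0\<bar> \<le> 1" if "r \<in> {0..h}" for r
  proof -
    have "\<bar>w r - w 0\<bar> \<le> C * r powr \<delta>"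
      using w that \<open>h \<le> T\<close> by simp
    also have "\<dots> \<le> C * h powr \<delta>"
      using that \<open>C > 0\<close> \<open>\<delta> > 0\<close> by (intro mult_left_mono powr_mono2) auto
    finally have "a * \<bar>w r - w 0\<bar> \<le> a * (C * h powr \<delta>)"
      using \<open>a > 0\<close> by simp
    also have "\<dots> = 1"
      using \<open>C > 0\<close> \<open>h > 0\<close> by (simp add: a_def)
    finally show ?thesis
      using \<open>a > 0\<close> by (simp add: abs_mult flip: right_diff_distrib)
  qed
  have "continuous_on {0..h} (\<lambda>r. a * w r)"
    using continuous_on_subset[OF \<open>continuous_on {0..T} w\<close>] \<open>h \<le> T\<close>
    by (intro continuous_on_mult_left) auto
  then have "(h - 0) * cos 1 \<le> cmod (Phi w h a)"
    unfolding Phi_def using near \<open>h > 0\<close> by (intro cmod_integral_exp_ge) auto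
  \<comment> \<open>\<open>Phi w 0 a\<close> is an integral over a single point, hence 0.\<close>
  then have Phi: "h * cos 1 \<le> cmod (Phi w h a - Phi w 0 a)"
    by (simp add: Phi_def)
  \<comment> \<open>In the exponent of \<open>h\<close>, 1 comes from the length of the interval,
    \<open>- \<gamma>\<close> from the denominator and \<open>- \<delta> * \<rho>\<close> from the
    weight \<open>a powr \<rho>\<close>.\<close>
  have "C powr - \<rho> * cos 1 * h powr (1 - \<gamma> - \<delta> * \<rho>) = a powr \<rho> * (h * cos 1 / h powr \<gamma>)"
    using \<open>C > 0\<close> \<open>h > 0\<close>
    by (simp add: a_def powr_divide powr_mult powr_powr powr_diff powr_minus divide_simps)
  also have "\<dots> \<le> (1 + \<bar>a\<bar>) powr \<rho> * (cmod (Phi w h a - Phi w 0 a) / \<bar>h - 0\<bar> powr \<gamma>)"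
    using \<open>a > 0\<close> \<open>\<rho> > 0\<close> \<open>h > 0\<close> cos_one_pos Phi
    by (intro mult_mono powr_mono2) (auto intro: divide_right_mono)
  finally show ?thesis
    using assms by (intro order_trans[OF ennreal_leI W_norm_upper]) auto
qed

theorem theorem1p5:
  fixes T \<delta> :: real and w :: "real \<Rightarrow> real"
  assumes "T > 0"
    and "0 < \<delta>" and "\<delta> \<le> 1"
    and "holder_on \<delta> {0..T} w"
  shows "\<forall>\<gamma> \<rho> :: real. \<gamma> > 0 \<longrightarrow> \<rho> > 0 \<longrightarrow> \<gamma> + \<delta> > 1 \<longrightarrow> \<rho> > (1 - \<gamma>) / \<delta>
    \<longrightarrow> W_norm \<rho> \<gamma> T (Phi w) = \<infinity>"
proof (intro allI impI)
  fix \<gamma> \<rho> :: real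
  assume "\<rho> > 0" and "\<rho> > (1 - \<gamma>) / \<delta>"
  \<comment> \<open>This is the lower bound on \<open>\<rho>\<close>, multiplied by
    \<open>\<delta> > 0\<close>.\<close>
  then have neg: "1 - \<gamma> - \<delta> * \<rho> < 0"
    using \<open>0 < \<delta>\<close> by (simp add: field_simps)
  obtain C where "C > 0"
    and C: "\<And>s t. s \<in> {0..T} \<Longrightarrow> t \<in> {0..T} \<Longrightarrow> \<bar>w t - w s\<bar> \<le> C * \<bar>t - s\<bar> powr \<delta>"
    using assms(4) by (rule holder_onE) blast
  define K where "K = C powr - \<rho> * cos 1"
  have "K > 0"
    using \<open>C > 0\<close> cos_one_pos by (simp add: K_def)
  have ge: "ennreal (K * h powr (1 - \<gamma> - \<delta> * \<rho>)) \<le> W_norm \<rho> \<gamma> T (Phi w)"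
    if "0 < h" "h \<le> T" for h
    unfolding K_def
    using that assms \<open>C > 0\<close> \<open>\<rho> > 0\<close> C[of 0] holder_on_imp_continuous_on[OF assms(4)]
    by (intro W_norm_Phi_ge) auto
  show "W_norm \<rho> \<gamma> T (Phi w) = \<infinity>"
  proof (cases "W_norm \<rho> \<gamma> T (Phi w)")
    case (real B)
    \<comment> \<open>A finite norm \<open>B\<close> would bound
      \<open>K * h powr (1 - \<gamma> - \<delta> * \<rho>)\<close> for all small
      \<open>h > 0\<close>, but a negative power blows up at 0.\<close>
    have "filterlim (\<lambda>h. K * h powr (1 - \<gamma> - \<delta> * \<rho>)) at_top (at_right 0)"
      using neg \<open>K > 0\<close> by real_asymp
    then have "eventually (\<lambda>h. B < K * h powr (1 - \<gamma> - \<delta> * \<rho>)) (at_right 0)"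
      by (simp add: filterlim_at_top_dense)
    moreover have "eventually (\<lambda>h. h \<in> {0<..<T}) (at_right 0)"
      using \<open>T > 0\<close> by (rule eventually_at_right_real)
    \<comment> \<open>The filter \<open>at_right 0\<close> is nontrivial, so this is absurd.\<close>
    ultimately have "eventually (\<lambda>h. False) (at_right (0 :: real))"
    proof eventually_elim
      case (elim h)
      then show False
        using ge[of h] real by simp
    qed
    then show ?thesis
      by simp
  qed simp
qed

end
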